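(* No quiver in the mutation class of $E_8^{(1,1)}$ has an admissible vector.
   Context: $E_8^{(1,1)}$ is the exceptional mutation-finite quiver (in the classification of Felikson–Shapiro–Tumarkin / Derksen–Owen) given by: vertices $a,b$ with a double arrow $a\Rightarrow b$; three vertices $x_1,x_2,x_3$, each with arrows $b\to x_i$ and $x_i\to a$; and pendant paths (single arrows, any orientation) attached at the $x_i$ so that the three "legs" starting at $x_1,x_2,x_3$ have $2,1,5$ vertices respectively (10 vertices in total). Quivers have no loops/2-cycles; $b_{ij}$ is the number of arrows $v_i\to v_j$ (negative if reversed); mutation $\mu_k$: $b'_{ij}=-b_{ij}$ if $k\in\{i,j\}$, else $b'_{ij}=b_{ij}+\mathrm{sgn}(b_{ik})[b_{ik}b_{kj}]_+$. For a quiver $Q$ on mutable vertices $v_1,\dots,v_n$ and $\boldsymbol b\in\mathbb Z^n$, add a frozen vertex $q$ with $b_i$ arrows from $v_i$ to $q$; mutations only at mutable vertices. $\boldsymbol b$ is admissible if $\boldsymbol b\neq0$ and the resulting quiver with frozen vertex has finite mutation class. *)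

theory Defs
  imports Main
begin

text \<open>
  A matrix \<open>Q :: 'v \<Rightarrow> 'v \<Rightarrow> int\<close> represents a quiver on the vertex set \<open>'v\<close>: \<open>Q u v\<close> is the
  number of arrows \<open>u \<rightarrow> v\<close>, counted negatively if the arrows go from \<open>v\<close> to \<open>u\<close>. Skew-symmetry
  encodes the absence of loops and 2-cycles.
\<close>

type_synonym 'v quiver = "'v \<Rightarrow> 'v \<Rightarrow> int"

definition is_quiver :: "'v quiver \<Rightarrow> bool" where
  "is_quiver Q \<longleftrightarrow> (\<forall>u v. Q u v = - Q v u)"

definition mutate :: "'v \<Rightarrow> 'v quiver \<Rightarrow> 'v quiver" where
  "mutate k Q = (\<lambda>i j. if k = i \<or> k = j then - Q i j
                      else Q i j + sgn (Q i k) * max 0 (Q i k * Q k j))"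

text \<open>The vertices in \<open>M\<close> are the mutable ones. Vertices stay labelled; on a finite vertex set
  this class is finite iff it is finite up to isomorphism.\<close>

inductive_set mutation_class :: "'v set \<Rightarrow> 'v quiver \<Rightarrow> 'v quiver set"
  for M :: "'v set" and Q :: "'v quiver" where
  base: "Q \<in> mutation_class M Q"
| step: "R \<in> mutation_class M Q \<Longrightarrow> k \<in> M \<Longrightarrow> mutate k R \<in> mutation_class M Q"

text \<open>The frozen vertex is \<open>None\<close>.\<close>

definition add_frozen :: "'v quiver \<Rightarrow> ('v \<Rightarrow> int) \<Rightarrow> 'v option quiver" where
  "add_frozen Q b = (\<lambda>s t. case (s, t) of
       (Some i, Some j) \<Rightarrow> Q i j
     | (Some i, None) \<Rightarrow> b i
     | (None, Some j) \<Rightarrow> - b j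
     | (None, None) \<Rightarrow> 0)"

definition admissible :: "'v::finite quiver \<Rightarrow> ('v \<Rightarrow> int) \<Rightarrow> bool" where
  "admissible Q b \<longleftrightarrow>
     (\<exists>i. b i \<noteq> 0) \<and> finite (mutation_class (range Some) (add_frozen Q b))"

text \<open>Legs: \<open>x1, y2\<close>; \<open>x2\<close>; \<open>x3, z2, z3, z4, z5\<close>. Absolute values leave the orientation of the
  pendant paths free.\<close>

definition is_E8_11 :: "'v::finite quiver \<Rightarrow> bool" where
  "is_E8_11 Q \<longleftrightarrow> is_quiver Q \<and>
     (\<exists>a b x1 y2 x2 x3 z2 z3 z4 z5.
        distinct [a, b, x1, y2, x2, x3, z2, z3, z4, z5] \<and>
        UNIV = {a, b, x1, y2, x2, x3, z2, z3, z4, z5} \<and>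
        Q a b = 2 \<and>
        Q b x1 = 1 \<and> Q x1 a = 1 \<and>
        Q b x2 = 1 \<and> Q x2 a = 1 \<and>
        Q b x3 = 1 \<and> Q x3 a = 1 \<and>
        \<bar>Q x1 y2\<bar> = 1 \<and>
        \<bar>Q x3 z2\<bar> = 1 \<and> \<bar>Q z2 z3\<bar> = 1 \<and> \<bar>Q z3 z4\<bar> = 1 \<and> \<bar>Q z4 z5\<bar> = 1 \<and>
        (\<forall>u v. Q u v \<noteq> 0 \<longrightarrow>
           {u, v} \<in> {{a, b}, {b, x1}, {x1, a}, {b, x2}, {x2, a}, {b, x3}, {x3, a},
                     {x1, y2}, {x3, z2}, {z2, z3}, {z3, z4}, {z4, z5}}))"

end

theory Submission
  imports Defs
begin

text \<open>
  Framing vectors with finite mutation class are carried to such vectors by mutation, and mutation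
  is an involution, so it suffices to treat the standard quiver with its legs oriented outwards.
  At a double arrow \<open>u \<Rightarrow> v\<close> such a vector must satisfy \<open>b u + b v = 0\<close> and \<open>b v \<ge> 0\<close>: otherwise
  mutating alternately at \<open>u\<close> and \<open>v\<close> makes the entries grow without bound. Heuristically,
  in the language of tubular weighted projective lines, a double arrow singles out a slope, and its
  condition selects the vectors concentrated in that slope. A word of 14 mutations leads from the double
  arrow \<open>a \<Rightarrow> b\<close> to a double arrow of another slope, and the two conditions together force the
  vector to vanish: the second one bounds a sum of nonnegative terms by zero.
\<close>

section \<open>Framing vectors and their transport under mutation\<close>

definition mutate_vec :: "'v \<Rightarrow> 'v quiver \<Rightarrow> ('v \<Rightarrow> int) \<Rightarrow> 'v \<Rightarrow> int" where
  "mutate_vec k Q b = (\<lambda>i. if i = k then - b k else b i + sgn (Q i k) * max 0 (Q i k * b k))"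

definition finite_framing :: "'v::finite quiver \<Rightarrow> ('v \<Rightarrow> int) \<Rightarrow> bool" where
  "finite_framing Q b \<longleftrightarrow> finite (mutation_class (range Some) (add_frozen Q b))"

definition no_admissible :: "'v::finite quiver \<Rightarrow> bool" where
  "no_admissible Q \<longleftrightarrow> (\<forall>b. finite_framing Q b \<longrightarrow> (\<forall>i. b i = 0))"

lemma is_quiver_swap: "is_quiver Q \<Longrightarrow> Q v u = - Q u v"
  unfolding is_quiver_def by blast

lemma is_quiver_diag [simp]: "is_quiver Q \<Longrightarrow> Q u u = 0"
  using is_quiver_swap[of Q u u] by simp

text \<open>Both sides vanish unless \<open>x\<close> and \<open>y\<close> have the same sign. Hence
  the mutation rule respects skew-symmetry although it takes its sign from \<open>Q i k\<close>
  alone.\<close>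

lemma sgn_max_commute: "sgn y * max 0 (y * x) = sgn x * max 0 (x * y)" for x y :: int
  by (cases x "0 :: int" rule: linorder_cases; cases y "0 :: int" rule: linorder_cases)
    (simp_all add: mult.commute mult_pos_neg mult_neg_pos less_imp_le max_absorb1)

lemma is_quiver_mutate:
  assumes "is_quiver Q"
  shows "is_quiver (mutate k Q)"
proof -
  have "mutate k Q u v = - mutate k Q v u" for u v
    using is_quiver_swap[OF assms, of u v] is_quiver_swap[OF assms, of v k]
      is_quiver_swap[OF assms, of k u] sgn_max_commute[of "Q k v" "Q u k"]
    by (auto simp: mutate_def)
  then show ?thesis
    unfolding is_quiver_def by blast
qed

lemma mutate_mutate:
  assumes "is_quiver Q"
  shows "mutate k (mutate k Q) = Q"
  using assms by (auto simp: mutate_def fun_eq_iff)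

lemma mutate_add_frozen:
  assumes "is_quiver Q"
  shows "mutate (Some k) (add_frozen Q b) = add_frozen (mutate k Q) (mutate_vec k Q b)"
proof (intro ext)
  fix s t
  show "mutate (Some k) (add_frozen Q b) s t = add_frozen (mutate k Q) (mutate_vec k Q b) s t"
    using is_quiver_swap[OF assms, of k]
    by (cases s; cases t)
      (auto simp: mutate_def add_frozen_def mutate_vec_def sgn_max_commute[of "b k"])
qed

lemma mutation_class_trans:
  assumes "S \<in> mutation_class M R" "R \<in> mutation_class M Q"
  shows "S \<in> mutation_class M Q"
  using assms by induction (auto intro: mutation_class.step)

lemma finite_framing_mutate:
  assumes "is_quiver Q" "finite_framing Q b"
  shows "finite_framing (mutate k Q) (mutate_vec k Q b)"
proof -
  have "mutate (Some k) (add_frozen Q b) \<in> mutation_class (range Some) (add_frozen Q b)"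
    by (intro mutation_class.intros) simp
  then have "mutation_class (range Some) (mutate (Some k) (add_frozen Q b))
      \<subseteq> mutation_class (range Some) (add_frozen Q b)"
    using mutation_class_trans by blast
  then show ?thesis
    using assms finite_subset unfolding finite_framing_def
    by (simp add: mutate_add_frozen)
qed

text \<open>The entry at \<open>k\<close> is negated and drives every other change, so only the zero
  vector mutates to zero.\<close>

lemma no_admissible_mutateD:
  assumes "is_quiver Q" "no_admissible (mutate k Q)"
  shows "no_admissible Q"
  unfolding no_admissible_def
proof (intro allI impI)
  fix b i
  assume "finite_framing Q b"
  then have zero: "mutate_vec k Q b i = 0" for i
    using assms finite_framing_mutate unfolding no_admissible_def by blast
  have "b k = 0"
    using zero[of k] by (simp add: mutate_vec_def)
  then show "b i = 0"
    using zero[of i] by (simp add: mutate_vec_def split: if_splits)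
qed

lemma mutation_class_no_admissible:
  assumes "Q \<in> mutation_class M Q0" "is_quiver Q0" "no_admissible Q0"
  shows "is_quiver Q \<and> no_admissible Q"
  using assms
proof induction
  case (step R k)
  then have R: "is_quiver R" "no_admissible R"
    by auto
  have "no_admissible (mutate k R)"
    by (rule no_admissible_mutateD[of _ k]) (simp_all add: R is_quiver_mutate mutate_mutate)
  then show ?case
    by (simp add: R is_quiver_mutate)
qed auto

subsection \<open>Double arrows\<close>

text \<open>One bound \<open>K\<close> for the whole class survives mutation, so it can stay fixed
  in the measures of the inductions below.\<close>

definition bounded_framing :: "int \<Rightarrow> 'v quiver \<Rightarrow> ('v \<Rightarrow> int) \<Rightarrow> bool" where
  "bounded_framing K Q b \<longleftrightarrow>
     (\<forall>R \<in> mutation_class (range Some) (add_frozen Q b). \<forall>i. \<bar>R (Some i) None\<bar> \<le> K)"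

lemma finite_framing_bounded:
  fixes Q :: "'v::finite quiver"
  assumes "finite_framing Q b"
  obtains K where "bounded_framing K Q b"
proof -
  define X where "X = (\<lambda>(R, i). \<bar>R (Some i) None\<bar>) `
    (mutation_class (range Some) (add_frozen Q b) \<times> (UNIV :: 'v set))"
  have "finite X"
    using assms unfolding X_def finite_framing_def by simp
  then have "bounded_framing (Max X) Q b"
    unfolding bounded_framing_def by (intro ballI allI Max_ge) (auto simp: X_def)
  then show thesis
    by (rule that)
qed

lemma bounded_framing_le:
  assumes "bounded_framing K Q b"
  shows "\<bar>b i\<bar> \<le> K"
proof -
  have "\<bar>add_frozen Q b (Some i) None\<bar> \<le> K"
    using assms mutation_class.base unfolding bounded_framing_def by blast
  then show ?thesis
    by (simp add: add_frozen_def)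
qed

lemma bounded_framing_mutate:
  assumes "is_quiver Q" "bounded_framing K Q b"
  shows "bounded_framing K (mutate k Q) (mutate_vec k Q b)"
proof -
  have "mutate (Some k) (add_frozen Q b) \<in> mutation_class (range Some) (add_frozen Q b)"
    by (intro mutation_class.intros) simp
  then show ?thesis
    using assms mutation_class_trans unfolding bounded_framing_def
    by (metis mutate_add_frozen)
qed

text \<open>Alternating mutations at the two ends of a double arrow preserve \<open>b u + b v\<close> once
  \<open>b u \<le> 0\<close> (dually \<open>b v \<ge> 0\<close>), and shift \<open>b u\<close> (dually \<open>b v\<close>) by this sum.\<close>

lemma double_arrow_unbounded_below:
  assumes "is_quiver Q" "bounded_framing K Q b" "Q u v = 2" "b u \<le> 0" "b u + b v < 0"
  shows False
  using assms
proof (induction "nat (K + b u)" arbitrary: Q b u v rule: less_induct)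
  case less
  have vu: "Q v u = - 2"
    using is_quiver_swap[OF less.prems(1), of v u] less.prems(3) by simp
  then have neq: "u \<noteq> v"
    using less.prems(3) by auto
  let ?Q = "mutate u Q" and ?b = "mutate_vec u Q b"
  have bv: "?b v = b v + 2 * b u" and bu: "?b u = - b u"
    using vu neq less.prems(4) by (auto simp: mutate_vec_def max_def)
  have "\<bar>b u\<bar> \<le> K" "\<bar>?b v\<bar> \<le> K"
    by (rule bounded_framing_le, rule less.prems bounded_framing_mutate[OF less.prems(1,2)])+
  then have "nat (K + ?b v) < nat (K + b u)"
    using bv less.prems(5) by linarith
  then show False
  proof (rule less.hyps[where Q = ?Q and b = ?b and u = v and v = u])
    show "?Q v u = 2"
      using vu by (simp add: mutate_def)
  qed (use less.prems bv bu is_quiver_mutate bounded_framing_mutate in auto)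
qed

lemma double_arrow_unbounded_above:
  assumes "is_quiver Q" "bounded_framing K Q b" "Q u v = 2" "b v \<ge> 0" "b u + b v > 0"
  shows False
  using assms
proof (induction "nat (K - b v)" arbitrary: Q b u v rule: less_induct)
  case less
  have vu: "Q v u = - 2"
    using is_quiver_swap[OF less.prems(1), of v u] less.prems(3) by simp
  then have neq: "u \<noteq> v"
    using less.prems(3) by auto
  let ?Q = "mutate v Q" and ?b = "mutate_vec v Q b"
  have bu: "?b u = b u + 2 * b v" and bv: "?b v = - b v"
    using less.prems(3,4) neq by (auto simp: mutate_vec_def max_def)
  have "\<bar>b v\<bar> \<le> K" "\<bar>?b u\<bar> \<le> K"
    by (rule bounded_framing_le, rule less.prems bounded_framing_mutate[OF less.prems(1,2)])+
  then have "nat (K - ?b u) < nat (K - b v)"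
    using bu less.prems(5) by linarith
  then show False
  proof (rule less.hyps[where Q = ?Q and b = ?b and u = v and v = u])
    show "?Q v u = 2"
      using vu by (simp add: mutate_def)
  qed (use less.prems bv bu is_quiver_mutate bounded_framing_mutate in auto)
qed

lemma finite_framing_double_arrow:
  fixes Q :: "'v::finite quiver"
  assumes Q: "is_quiver Q" and "finite_framing Q b" and uv: "Q u v = 2"
  shows "b u + b v = 0 \<and> b v \<ge> 0"
proof -
  obtain K where K: "bounded_framing K Q b"
    using assms finite_framing_bounded by blast
  have vu: "Q v u = - 2"
    using is_quiver_swap[OF Q, of v u] uv by simp
  then have neq: "u \<noteq> v"
    using uv by auto
  note mut = is_quiver_mutate[OF Q] bounded_framing_mutate[OF Q K]
  have arrow: "mutate u Q v u = 2" "mutate v Q v u = 2"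
    using vu by (simp_all add: mutate_def)
  \<comment> \<open>In these two cases mutation only negates the entry at the mutated end, which
    leads to the hypotheses of the growth lemmas. The boundary case \<open>b v = - b u\<close> of
    \<open>below\<close> yields \<open>b v \<ge> 0\<close>.\<close>
  have below: False if "b u > 0" "b v \<le> - b u" "b v < 0"
    by (rule double_arrow_unbounded_below[OF mut arrow(1)])
      (use that vu neq in \<open>auto simp: mutate_vec_def\<close>)
  have above: False if "b v < 0" "b u > - b v"
    by (rule double_arrow_unbounded_above[OF mut arrow(2)])
      (use that uv neq in \<open>auto simp: mutate_vec_def\<close>)
  show ?thesis
    using below above double_arrow_unbounded_below[OF Q K uv]
      double_arrow_unbounded_above[OF Q K uv]
    by (smt (verit))
qed

subsection \<open>Symbolic mutation of framings along concrete matrices\<close>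

definition quiver_mat :: "'v list \<Rightarrow> 'v quiver \<Rightarrow> int list list" where
  "quiver_mat vs Q = map (\<lambda>u. map (Q u) vs) vs"

lemma quiver_mat_nth:
  "i < length vs \<Longrightarrow> j < length vs \<Longrightarrow> quiver_mat vs Q ! i ! j = Q (vs ! i) (vs ! j)"
  by (simp add: quiver_mat_def)

definition mutate_mat :: "nat \<Rightarrow> int list list \<Rightarrow> int list list" where
  "mutate_mat k A =
     (map (\<lambda>r. (map2 (\<lambda>x y. x + sgn (r ! k) * max 0 (r ! k * y)) r (A ! k))[k := - (r ! k)]) A)
       [k := map uminus (A ! k)]"

lemma quiver_mat_mutate:
  assumes "distinct vs" "k < length vs"
  shows "quiver_mat vs (mutate (vs ! k) Q) = mutate_mat k (quiver_mat vs Q)"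
  using assms
  by (intro nth_equalityI)
    (auto simp: quiver_mat_def mutate_mat_def mutate_def nth_list_update nth_eq_iff_index_eq)

text \<open>Naming both parts of an entry keeps the mutation formulas linear, so linear arithmetic
  suffices without splitting on signs.\<close>

definition parts :: "int \<Rightarrow> int \<Rightarrow> int \<Rightarrow> bool" where
  "parts p n y \<longleftrightarrow> p = max 0 y \<and> n = max 0 (- y)"

lemma partsD:
  assumes "parts p n y"
  shows "y = p - n" "0 \<le> p" "0 \<le> n"
  using assms unfolding parts_def by linarith+

lemma parts_nonneg: "parts p n y \<Longrightarrow> 0 \<le> y \<Longrightarrow> n = 0"
  and parts_nonpos: "parts p n y \<Longrightarrow> y \<le> 0 \<Longrightarrow> p = 0"
  unfolding parts_def by simp_all

text \<open>\<open>p\<close> and \<open>n\<close> are the parts of the entry at the mutated vertex \<open>k\<close>, and \<open>c\<close> is the \<open>k\<close>-th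
  column of the matrix.\<close>

definition update_vec :: "nat \<Rightarrow> int list \<Rightarrow> int \<Rightarrow> int \<Rightarrow> int list \<Rightarrow> int list" where
  "update_vec k c p n x =
     (map2 (\<lambda>y m. if m = 0 then y else if m > 0 then y + m * p else y + m * n) x c)[k := n - p]"

lemma mutate_vec_update_vec:
  assumes "distinct vs" "k < length vs"
  shows "map (mutate_vec (vs ! k) Q b) vs =
    update_vec k (map (\<lambda>r. r ! k) (quiver_mat vs Q)) (max 0 (b (vs ! k))) (max 0 (- b (vs ! k)))
      (map b vs)"
  using assms
  by (intro nth_equalityI)
    (auto simp: quiver_mat_def mutate_vec_def update_vec_def nth_list_update nth_eq_iff_index_eq
      sgn_if max_def zero_le_mult_iff mult_le_0_iff)

fun columns :: "nat list \<Rightarrow> int list list \<Rightarrow> (nat \<times> int list) list" where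
  "columns [] A = []"
| "columns (k # ks) A = (k, map (\<lambda>r. r ! k) A) # columns ks (mutate_mat k A)"

fun along :: "(nat \<times> int list) list \<Rightarrow> int list \<Rightarrow> (int list \<Rightarrow> bool) \<Rightarrow> bool" where
  "along [] x P = P x"
| "along ((k, c) # cs) x P \<longleftrightarrow> (\<exists>p n. parts p n (x ! k) \<and> along cs (update_vec k c p n x) P)"

text \<open>Finiteness persists along the word, so whatever it forces at the last matrix becomes a
  constraint on the initial vector.\<close>

lemma finite_framing_along:
  assumes "distinct vs" "is_quiver Q" "finite_framing Q b" "set ks \<subseteq> {..<length vs}"
    and "\<And>Q' b'. is_quiver Q' \<Longrightarrow> finite_framing Q' b' \<Longrightarrow>
      quiver_mat vs Q' = fold mutate_mat ks (quiver_mat vs Q) \<Longrightarrow> P (map b' vs)"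
  shows "along (columns ks (quiver_mat vs Q)) (map b vs) P"
  using assms
proof (induction ks arbitrary: Q b)
  case (Cons k ks)
  let ?v = "vs ! k"
  let ?p = "max 0 (b ?v)" and ?n = "max 0 (- b ?v)"
  have k: "k < length vs"
    using Cons.prems(4) by simp
  have "along (columns ks (quiver_mat vs (mutate ?v Q))) (map (mutate_vec ?v Q b) vs) P"
    by (rule Cons.IH)
      (use Cons.prems k in \<open>auto simp: is_quiver_mutate finite_framing_mutate quiver_mat_mutate\<close>)
  moreover have "parts ?p ?n (map b vs ! k)"
    using k by (simp add: parts_def)
  ultimately show ?case
    unfolding columns.simps along.simps quiver_mat_mutate[OF Cons.prems(1) k]
      mutate_vec_update_vec[OF Cons.prems(1) k] by blast
qed simp

definition no_admissible_mat :: "'v::finite list \<Rightarrow> int list list \<Rightarrow> bool" where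
  "no_admissible_mat vs A \<longleftrightarrow>
     (\<forall>Q. is_quiver Q \<longrightarrow> quiver_mat vs Q = A \<longrightarrow> no_admissible Q)"

lemma no_admissible_mat_foldD:
  assumes "distinct vs" "set ks \<subseteq> {..<length vs}" "no_admissible_mat vs (fold mutate_mat ks A)"
  shows "no_admissible_mat vs A"
  using assms
proof (induction ks arbitrary: A)
  case (Cons k ks)
  then have "no_admissible_mat vs (mutate_mat k A)"
    by simp
  then show ?case
    using Cons.prems no_admissible_mutateD is_quiver_mutate quiver_mat_mutate[of vs k]
    unfolding no_admissible_mat_def by (metis insert_subset lessThan_iff list.simps(15))
qed simp

subsection \<open>The elliptic quiver of type E8\<close>

text \<open>The vertices are ordered as \<open>a, b, x1, y2, x2, x3, z2, z3, z4, z5\<close>, and the arguments are the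
  orientations of the five edges in the legs.\<close>

definition E8_mat :: "int \<Rightarrow> int \<Rightarrow> int \<Rightarrow> int \<Rightarrow> int \<Rightarrow> int list list" where
  "E8_mat c d e f g =
    [[0, 2, -1, 0, -1, -1, 0, 0, 0, 0],
     [-2, 0, 1, 0, 1, 1, 0, 0, 0, 0],
     [1, -1, 0, c, 0, 0, 0, 0, 0, 0],
     [0, 0, - c, 0, 0, 0, 0, 0, 0, 0],
     [1, -1, 0, 0, 0, 0, 0, 0, 0, 0],
     [1, -1, 0, 0, 0, 0, d, 0, 0, 0],
     [0, 0, 0, 0, 0, - d, 0, e, 0, 0],
     [0, 0, 0, 0, 0, 0, - e, 0, f, 0],
     [0, 0, 0, 0, 0, 0, 0, - f, 0, g],
     [0, 0, 0, 0, 0, 0, 0, 0, - g, 0]]"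

text \<open>Found by computer search for a mutation sequence leading to a double arrow whose condition is
  violated by the vector \<open>-1, 1\<close> on \<open>a, b\<close> and zero elsewhere.\<close>

definition E8_word :: "nat list" where
  "E8_word = [2, 4, 0, 5, 6, 7, 0, 1, 3, 8, 7, 1, 2, 9]"

lemma E8_columns:
  "columns E8_word (E8_mat 1 1 1 1 1) =
    [(2, [-1, 1, 0, -1, 0, 0, 0, 0, 0, 0]),
     (4, [-1, 1, 0, 0, 0, 0, 0, 0, 0, 0]),
     (0, [0, 0, -1, 0, -1, 1, 0, 0, 0, 0]),
     (5, [1, 1, -1, 0, -1, 0, -1, 0, 0, 0]),
     (6, [1, 1, 0, 0, 0, -1, 0, -1, 0, 0]),
     (7, [1, 1, 0, 0, 0, 0, -1, 0, -1, 0]),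
     (0, [0, 0, 0, 0, 0, 0, 0, 1, -1, 0]),
     (1, [0, 0, 0, -1, 0, 0, 0, 1, -1, 0]),
     (3, [0, -1, -1, 0, 0, 0, 0, 1, 0, 0]),
     (8, [-1, -1, 0, 0, 0, 0, 0, 1, 0, -1]),
     (7, [0, -1, -1, 1, 0, 0, 1, 0, 1, -1]),
     (1, [0, 0, 0, 0, 0, 0, 1, -1, 0, 0]),
     (2, [0, 0, 0, 0, 0, -1, 1, -1, 1, 0]),
     (9, [0, 0, 0, 1, 0, 0, 1, -1, 0, 0])]"
  by code_simp

lemma E8_double_arrow:
  "fold mutate_mat E8_word (E8_mat 1 1 1 1 1) ! 6 ! 7 = 2"
  by code_simp

lemma no_admissible_E8_mat:
  fixes vs :: "'v::finite list"
  assumes "distinct vs" "length vs = 10" "set vs = UNIV"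
  shows "no_admissible_mat vs (E8_mat 1 1 1 1 1)"
  unfolding no_admissible_mat_def no_admissible_def
proof (intro allI impI)
  fix Q and b :: "'v \<Rightarrow> int" and u
  assume Q: "is_quiver Q" and mat: "quiver_mat vs Q = E8_mat 1 1 1 1 1"
    and fin: "finite_framing Q b"
  have double: "map b' vs ! i + map b' vs ! j = 0 \<and> map b' vs ! j \<ge> 0"
    if "is_quiver Q'" "finite_framing Q' b'" "quiver_mat vs Q' ! i ! j = 2" "i < 10" "j < 10"
    for Q' b' i j
    using that finite_framing_double_arrow[of Q' b' "vs ! i" "vs ! j"] assms(2)
    by (simp add: quiver_mat_nth)
  have first: "map b vs ! 0 + map b vs ! 1 = 0 \<and> map b vs ! 1 \<ge> 0"
    by (rule double[OF Q fin]) (simp_all add: mat E8_mat_def)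
  \<comment> \<open>The word ends at a double arrow from position 6 to position 7, that is from
    \<open>z2\<close> to \<open>z3\<close>.\<close>
  have last: "along (columns E8_word (E8_mat 1 1 1 1 1)) (map b vs)
      (\<lambda>y. y ! 6 + y ! 7 = 0 \<and> y ! 7 \<ge> 0)"
    unfolding mat[symmetric]
  proof (rule finite_framing_along[OF assms(1) Q fin])
    show "set E8_word \<subseteq> {..<length vs}"
      by (simp add: E8_word_def assms(2))
    show "map b' vs ! 6 + map b' vs ! 7 = 0 \<and> map b' vs ! 7 \<ge> 0"
      if "is_quiver Q'" "finite_framing Q' b'"
        "quiver_mat vs Q' = fold mutate_mat E8_word (quiver_mat vs Q)" for Q' b'
      by (rule double[OF that(1,2)]) (simp_all add: that(3) mat E8_double_arrow)
  qed
  obtain x0 x1 x2 x3 x4 x5 x6 x7 x8 x9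
    where x: "map b vs = [x0, x1, x2, x3, x4, x5, x6, x7, x8, x9]"
  proof -
    have "length (map b vs) = 10"
      using assms(2) by simp
    then show thesis
      using that by (auto simp: numeral_eq_Suc length_Suc_conv)
  qed
  have kronecker: "x0 + x1 = 0" "0 \<le> x1"
    using first unfolding x by simp_all
  \<comment> \<open>The parts are numbered by the steps of the word, the \<open>x\<close>-variables
    by position: \<open>x0\<close> and \<open>x1\<close> are the entries at \<open>a\<close> and
    \<open>b\<close>.\<close>
  obtain p0 n0 p1 n1 p2 n2 p3 n3 p4 n4 p5 n5 p6 n6 p7 n7 p8 n8 p9 n9 p10 n10 p11 n11 p12 n12 p13 n13
    where steps: "parts p0 n0 x2" "parts p1 n1 x4" "parts p2 n2 (x0 - n0 - n1)"
      "parts p3 n3 (x5 + p2)" "parts p4 n4 (x6 - n3)" "parts p5 n5 (x7 - n4)"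
      "parts p6 n6 (n2 - p2 + p3 + p4 + p5)" "parts p7 n7 (x1 + p0 + p1 + p3 + p4 + p5)"
      "parts p8 n8 (x3 - n0 - n7)" "parts p9 n9 (x8 - n5 - n6 - n7)"
      "parts p10 n10 (n5 - p5 + p6 + p7 + p8 + p9)" "parts p11 n11 (n7 - p7 - n8 - n9 - n10)"
      "parts p12 n12 (n0 - p0 - n2 - n3 - n8 - n10)" "parts p13 n13 (x9 - n9 - n10)"
    and final: "n4 + p11 + p12 + p13 + n10 - n5 - p4 - n11 - n12 - n13 = 0"
      "n11 + n12 + n13 + p10 \<le> n10"
    using last unfolding x E8_columns
    by (simp add: update_vec_def, elim exE conjE) (rule that, assumption+, linarith+)
  note eqs = steps[THEN partsD(1)] and nonneg = steps[THEN partsD(2)] steps[THEN partsD(3)]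
  \<comment> \<open>Since \<open>x0 \<le> 0 \<le> x1\<close>, the signs of the entries mutated at
    steps 2, 6 and 7 are forced.\<close>
  have p2: "p2 = 0"
    by (rule parts_nonpos[OF steps(3)]) (use kronecker nonneg in linarith)
  have n6: "n6 = 0"
    by (rule parts_nonneg[OF steps(7)]) (use p2 nonneg in linarith)
  have n7: "n7 = 0"
    by (rule parts_nonneg[OF steps(8)]) (use kronecker nonneg in linarith)
  have p10: "p10 - n10 = x1 + n2 + n5 + p0 + p1 + 2 * p3 + 2 * p4 + p5 + p8 + p9"
    using eqs p2 n6 n7 by linarith
  have n10: "n10 = 0"
    by (rule parts_nonneg[OF steps(11)]) (use eqs p10 kronecker nonneg in linarith)
  \<comment> \<open>Now \<open>p10\<close> is a sum of nonnegative terms, but \<open>final\<close> bounds it by 0.\<close>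
  have "p10 = 0" "n11 = 0" "n12 = 0" "n13 = 0"
    using final(2) n10 nonneg by linarith+
  then have "x1 = 0" "n2 = 0" "n5 = 0" "p0 = 0" "p1 = 0" "p3 = 0" "p4 = 0" "p5 = 0" "p8 = 0" "p9 = 0"
    using p10 n10 kronecker nonneg by linarith+
  note zero = this p2 n6 n7 n10 \<open>p10 = 0\<close> \<open>n11 = 0\<close> \<open>n12 = 0\<close> \<open>n13 = 0\<close>
  \<comment> \<open>Inserting the known zeros leaves, in each equation used, a sum of nonnegative
    terms equal to zero.\<close>
  have n01: "n0 = 0" "n1 = 0" and p7: "p7 = 0"
    using zero kronecker(1) nonneg(15,16) eqs(3,8) by linarith+
  have n89: "n8 = 0" "n9 = 0" and p11: "p11 = 0"
    using zero p7 nonneg(12,23,24) eqs(12) by linarith+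
  have n3: "n3 = 0" and p12: "p12 = 0"
    using zero n01 n89 nonneg(13,18) eqs(13) by linarith+
  have "n4 = 0" "p13 = 0"
    using zero p11 p12 nonneg(14,19) final(1) by linarith+
  then have "x0 = 0 \<and> x1 = 0 \<and> x2 = 0 \<and> x3 = 0 \<and> x4 = 0 \<and>
      x5 = 0 \<and> x6 = 0 \<and> x7 = 0 \<and> x8 = 0 \<and> x9 = 0"
    using zero n01 n3 n89 kronecker(1) eqs by simp
  then have "\<forall>y \<in> set (map b vs). y = 0"
    unfolding x by simp
  then show "b u = 0"
    using assms(3) by simp
qed

text \<open>Mutating the vertices beyond a leg edge one after the other, always at a source, reverses
  that edge and restores the orientation of the edges further out.\<close>

lemma E8_mat_flip:
  "fold mutate_mat [3] (E8_mat (-1) d e f g) = E8_mat 1 d e f g"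
  "fold mutate_mat [6, 7, 8, 9] (E8_mat c (-1) 1 1 1) = E8_mat c 1 1 1 1"
  "fold mutate_mat [7, 8, 9] (E8_mat c d (-1) 1 1) = E8_mat c d 1 1 1"
  "fold mutate_mat [8, 9] (E8_mat c d e (-1) 1) = E8_mat c d e 1 1"
  "fold mutate_mat [9] (E8_mat c d e f (-1)) = E8_mat c d e f 1"
  by (simp_all add: E8_mat_def mutate_mat_def)

lemma no_admissible_E8_mat_oriented:
  fixes vs :: "'v::finite list"
  assumes vs: "distinct vs" "length vs = 10" "set vs = UNIV"
    and signs: "\<bar>c\<bar> = 1" "\<bar>d\<bar> = 1" "\<bar>e\<bar> = 1" "\<bar>f\<bar> = 1" "\<bar>g\<bar> = 1"
  shows "no_admissible_mat vs (E8_mat c d e f g)"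
proof -
  have flip: "no_admissible_mat vs (A s)"
    if "fold mutate_mat ks (A (-1)) = A 1" "\<bar>s\<bar> = 1" "set ks \<subseteq> {..<10}" "no_admissible_mat vs (A 1)"
    for ks s and A :: "int \<Rightarrow> int list list"
  proof -
    have "s = 1 \<or> s = -1"
      using that(2) by linarith
    then show ?thesis
      using that no_admissible_mat_foldD[OF vs(1), of ks "A (-1)"] vs(2) by auto
  qed
  \<comment> \<open>On the long leg the orientations are freed from the inside out: the flips of its
    inner edges need the edges further out to point outwards.\<close>
  have "no_admissible_mat vs (E8_mat c 1 1 1 1)"
    by (rule flip[OF E8_mat_flip(1) signs(1)]) (simp_all add: no_admissible_E8_mat vs)
  then have "no_admissible_mat vs (E8_mat c d 1 1 1)"
    by (intro flip[OF E8_mat_flip(2) signs(2)]) simp_all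
  then have "no_admissible_mat vs (E8_mat c d e 1 1)"
    by (intro flip[OF E8_mat_flip(3) signs(3)]) simp_all
  then have "no_admissible_mat vs (E8_mat c d e f 1)"
    by (intro flip[OF E8_mat_flip(4) signs(4)]) simp_all
  then show ?thesis
    by (intro flip[OF E8_mat_flip(5) signs(5)]) simp_all
qed

section \<open>From the labelled quiver to its matrix, and conclusion\<close>

lemma is_E8_11_quiver_mat:
  fixes Q :: "'v::finite quiver"
  assumes "is_E8_11 Q"
  obtains vs c d e f g where "distinct vs" "length vs = 10" "set vs = UNIV"
    "\<bar>c\<bar> = 1" "\<bar>d\<bar> = 1" "\<bar>e\<bar> = 1" "\<bar>f\<bar> = 1" "\<bar>g\<bar> = 1"
    "quiver_mat vs Q = E8_mat c d e f g"
proof -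
  have Q: "is_quiver Q"
    using assms unfolding is_E8_11_def by blast
  obtain a b x1 y2 x2 x3 z2 z3 z4 z5 where
    dist: "distinct [a, b, x1, y2, x2, x3, z2, z3, z4, z5]" and
    univ: "UNIV = {a, b, x1, y2, x2, x3, z2, z3, z4, z5}" and
    arrows: "Q a b = 2" "Q b x1 = 1" "Q x1 a = 1" "Q b x2 = 1" "Q x2 a = 1" "Q b x3 = 1"
      "Q x3 a = 1"
    and signs: "\<bar>Q x1 y2\<bar> = 1" "\<bar>Q x3 z2\<bar> = 1" "\<bar>Q z2 z3\<bar> = 1"
      "\<bar>Q z3 z4\<bar> = 1" "\<bar>Q z4 z5\<bar> = 1"
    and edges: "\<forall>u v. Q u v \<noteq> 0 \<longrightarrow>
      {u, v} \<in> {{a, b}, {b, x1}, {x1, a}, {b, x2}, {x2, a}, {b, x3}, {x3, a},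
        {x1, y2}, {x3, z2}, {z2, z3}, {z3, z4}, {z4, z5}}"
    using assms unfolding is_E8_11_def by (elim conjE exE) blast
  have zero: "Q u v = 0"
    if "{u, v} \<notin> {{a, b}, {b, x1}, {x1, a}, {b, x2}, {x2, a}, {b, x3}, {x3, a},
        {x1, y2}, {x3, z2}, {z2, z3}, {z3, z4}, {z4, z5}}" for u v
    by (rule ccontr) (rule notE[OF that edges[rule_format]])
  note opp = is_quiver_swap[OF Q, of b a] is_quiver_swap[OF Q, of x1 b] is_quiver_swap[OF Q, of a x1]
    is_quiver_swap[OF Q, of x2 b] is_quiver_swap[OF Q, of a x2] is_quiver_swap[OF Q, of x3 b]
    is_quiver_swap[OF Q, of a x3] is_quiver_swap[OF Q, of y2 x1] is_quiver_swap[OF Q, of z2 x3]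
    is_quiver_swap[OF Q, of z3 z2] is_quiver_swap[OF Q, of z4 z3] is_quiver_swap[OF Q, of z5 z4]
  show thesis
  proof (rule that)
    show "quiver_mat [a, b, x1, y2, x2, x3, z2, z3, z4, z5] Q =
        E8_mat (Q x1 y2) (Q x3 z2) (Q z2 z3) (Q z3 z4) (Q z4 z5)"
      using dist[simplified]
      by (elim conjE) (simp add: quiver_mat_def E8_mat_def arrows opp Q zero doubleton_eq_iff)
  qed (use dist univ signs in simp_all)
qed

theorem theorem5p3:
  fixes Q0 Q :: "'v::finite quiver"
  assumes "is_E8_11 Q0"
    and "Q \<in> mutation_class UNIV Q0"
  shows "\<not> (\<exists>b :: 'v \<Rightarrow> int. admissible Q b)"
proof -
  have "is_quiver Q0"
    using assms(1) unfolding is_E8_11_def by blast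
  moreover obtain vs c d e f g where "quiver_mat vs Q0 = E8_mat c d e f g"
    "no_admissible_mat vs (E8_mat c d e f g)"
    using is_E8_11_quiver_mat[OF assms(1)] no_admissible_E8_mat_oriented by metis
  ultimately have "no_admissible Q"
    using mutation_class_no_admissible[OF assms(2)] unfolding no_admissible_mat_def by blast
  then show ?thesis
    unfolding no_admissible_def admissible_def finite_framing_def by blast
qed

end
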